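(* Let $(N,S)$ be any one of the four pairs $(\mathrm{nC},\mathrm{sC})$, $(\mathrm{nC3},\mathrm{sC3})$, $(\mathrm{nMC},\mathrm{sMC}^* )$, $(\mathrm{nCN},\mathrm{sCN}^* )$ consisting of a natural deduction system and a sequent calculus. For every formula $\alpha$, the sequent $\;\Rightarrow\alpha$ (with empty antecedent) is provable in $S$ if and only if $\alpha$ is provable in $N$.
   Context: Formulas are built from countably many propositional variables $p,q,\dots$ using the binary connectives $\land,\lor,\to$ and the unary connective $\sim$. SEQUENT CALCULI. A sequent is an expression $\Gamma\Rightarrow\gamma$ with $\Gamma$ a finite (possibly empty) set of formulas and $\gamma$ a single formula; $\alpha,\Gamma$ means $\{\alpha\}\cup\Gamma$ and $\Gamma,\Delta$ means $\Gamma\cup\Delta$. The calculus $\mathrm{sC}$ has the following initial sequents and rules ($p$ any propositional variable; $\alpha,\beta,\gamma$ any formulas; $\Gamma,\Delta,\Sigma$ any finite sets of formulas). Initial sequents: (init1) $p,\Gamma\Rightarrow p$; (init2) $\sim p,\Gamma\Rightarrow\sim p$. (cut): from $\Gamma\Rightarrow\alpha$ and $\alpha,\Sigma\Rightarrow\gamma$ infer $\Gamma,\Sigma\Rightarrow\gamma$. ($\to$left): from $\Gamma\Rightarrow\alpha$ and $\beta,\Delta\Rightarrow\gamma$ infer $\alpha\to\beta,\Gamma,\Delta\Rightarrow\gamma$. ($\to$right): from $\alpha,\Gamma\Rightarrow\beta$ infer $\Gamma\Rightarrow\alpha\to\beta$. ($\land$left): from $\alpha,\beta,\Gamma\Rightarrow\gamma$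 infer $\alpha\land\beta,\Gamma\Rightarrow\gamma$. ($\land$right): from $\Gamma\Rightarrow\alpha$ and $\Gamma\Rightarrow\beta$ infer $\Gamma\Rightarrow\alpha\land\beta$. ($\lor$left): from $\alpha,\Gamma\Rightarrow\gamma$ and $\beta,\Gamma\Rightarrow\gamma$ infer $\alpha\lor\beta,\Gamma\Rightarrow\gamma$. ($\lor$right1), ($\lor$right2): from $\Gamma\Rightarrow\alpha$ (respectively $\Gamma\Rightarrow\beta$) infer $\Gamma\Rightarrow\alpha\lor\beta$. ($\sim$left): from $\alpha,\Gamma\Rightarrow\gamma$ infer $\sim\sim\alpha,\Gamma\Rightarrow\gamma$. ($\sim$right): from $\Gamma\Rightarrow\alpha$ infer $\Gamma\Rightarrow\sim\sim\alpha$. ($\sim\to$left): from $\Gamma\Rightarrow\alpha$ and $\sim\beta,\Delta\Rightarrow\gamma$ infer $\sim(\alpha\to\beta),\Gamma,\Delta\Rightarrow\gamma$. ($\sim\to$right): from $\alpha,\Gamma\Rightarrow\sim\beta$ infer $\Gamma\Rightarrow\sim(\alpha\to\beta)$. ($\sim\land$left): from $\sim\alpha,\Gamma\Rightarrow\gamma$ and $\sim\beta,\Gamma\Rightarrow\gamma$ infer $\sim(\alpha\land\beta),\Gamma\Rightarrow\gamma$. ($\sim\land$right1), ($\sim\land$right2): from $\Gamma\Rightarrow\sim\alpha$ (respectively $\Gamma\Rightarrow\sim\beta$) infer $\Gamma\Rightarrow\sim(\alpha\land\beta)$. ($\sim\lor$left): from $\sim\alpha,\sim\beta,\Gamma\Rightarrow\gamma$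 infer $\sim(\alpha\lor\beta),\Gamma\Rightarrow\gamma$. ($\sim\lor$right): from $\Gamma\Rightarrow\sim\alpha$ and $\Gamma\Rightarrow\sim\beta$ infer $\Gamma\Rightarrow\sim(\alpha\lor\beta)$. Additional rules: (ex-middle): from $\sim\alpha,\Gamma\Rightarrow\gamma$ and $\alpha,\Gamma\Rightarrow\gamma$ infer $\Gamma\Rightarrow\gamma$. (g-ex-middle): from $\alpha\to\beta,\Gamma\Rightarrow\gamma$ and $\alpha,\Gamma\Rightarrow\gamma$ infer $\Gamma\Rightarrow\gamma$. $\mathrm{sC3}=\mathrm{sC}+$(ex-middle); $\mathrm{sMC}^*=\mathrm{sC}+$(g-ex-middle); $\mathrm{sCN}^*=\mathrm{sC3}+$(g-ex-middle). NATURAL DEDUCTION SYSTEMS. Derivations are Gentzen-style trees; a single assumption $\alpha$ is a derivation of $\alpha$ from itself. $[\alpha]$ marks assumptions discharged by a rule; a rule may discharge zero or more occurrences of the indicated assumption (vacuous discharge allowed). The rules of $\mathrm{nC}$ are: ($\to$I): from a derivation of $\beta$ from $[\alpha]$, infer $\alpha\to\beta$. ($\to$E): from $\alpha\to\beta$ and $\alpha$ infer $\beta$. ($\land$I): from $\alpha$ and $\beta$ infer $\alpha\land\beta$. ($\land$E1), ($\land$E2): from $\alpha\land\beta$ infer $\alpha$ (respectively $\beta$). ($\lor$I1), ($\lor$I2): from $\alpha$ (respectively $\beta$) infer $\alpha\lor\beta$. ($\lor$E): from $\alpha\lor\beta$, a derivation of $\gamma$ from $[\alpha]$, and a derivation of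 $\gamma$ from $[\beta]$, infer $\gamma$. ($\sim\sim$I): from $\alpha$ infer $\sim\sim\alpha$. ($\sim\sim$E): from $\sim\sim\alpha$ infer $\alpha$. ($\sim\to$I): from a derivation of $\sim\beta$ from $[\alpha]$, infer $\sim(\alpha\to\beta)$. ($\sim\to$E): from $\sim(\alpha\to\beta)$ and $\alpha$ infer $\sim\beta$. ($\sim\land$I1), ($\sim\land$I2): from $\sim\alpha$ (respectively $\sim\beta$) infer $\sim(\alpha\land\beta)$. ($\sim\land$E): from $\sim(\alpha\land\beta)$, a derivation of $\gamma$ from $[\sim\alpha]$, and a derivation of $\gamma$ from $[\sim\beta]$, infer $\gamma$. ($\sim\lor$I): from $\sim\alpha$ and $\sim\beta$ infer $\sim(\alpha\lor\beta)$. ($\sim\lor$E1), ($\sim\lor$E2): from $\sim(\alpha\lor\beta)$ infer $\sim\alpha$ (respectively $\sim\beta$). Additional rules: (EM): from a derivation of $\gamma$ from $[\sim\alpha]$ and a derivation of $\gamma$ from $[\alpha]$, infer $\gamma$. (GEM): from a derivation of $\gamma$ from $[\alpha\to\beta]$ and a derivation of $\gamma$ from $[\alpha]$, infer $\gamma$. $\mathrm{nC3}=\mathrm{nC}+$(EM); $\mathrm{nMC}=\mathrm{nC}+$(GEM); $\mathrm{nCN}=\mathrm{nC3}+$(GEM). A formula $\alpha$ is provable in a natural deduction system $N$ if there is a derivation in $N$ with no open (undischarged) assumptions whose end-formula is $\alpha$. *)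

theory Defs
  imports "HOL-Library.FSet" "HOL-Library.Multiset"
begin

datatype fm =
    Var nat
  | Conj fm fm (infixr "\<^bold>\<and>" 65)
  | Disj fm fm (infixr "\<^bold>\<or>" 62)
  | Imp fm fm (infixr "\<^bold>\<rightarrow>" 60)
  | Neg fm ("\<^bold>\<sim> _" [70] 70)

text \<open>The four calculi of each kind differ only in which of the two excluded-middle rules they
  have. \<open>E\<close> below is the set of those rules added to the base calculus.\<close>

datatype extra_rule = ExMiddle | GExMiddle

section \<open>Sequent calculi\<close>

text \<open>\<open>seq E \<Gamma> \<gamma>\<close>: the sequent \<open>\<Gamma> \<Rightarrow> \<gamma>\<close> is provable. Antecedents are finite sets, so the schematic
  \<open>\<Gamma>\<close> in a premise or conclusion \<open>finsert \<alpha> \<Gamma>\<close> may itself already contain \<open>\<alpha>\<close>.\<close>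

inductive seq :: "extra_rule set \<Rightarrow> fm fset \<Rightarrow> fm \<Rightarrow> bool" for E where
  init1: "seq E (finsert (Var p) \<Gamma>) (Var p)"
| init2: "seq E (finsert (\<^bold>\<sim> Var p) \<Gamma>) (\<^bold>\<sim> Var p)"
| cut: "seq E \<Gamma> \<alpha> \<Longrightarrow> seq E (finsert \<alpha> \<Sigma>) \<gamma> \<Longrightarrow> seq E (\<Gamma> |\<union>| \<Sigma>) \<gamma>"
| impL: "seq E \<Gamma> \<alpha> \<Longrightarrow> seq E (finsert \<beta> \<Delta>) \<gamma> \<Longrightarrow> seq E (finsert (\<alpha> \<^bold>\<rightarrow> \<beta>) (\<Gamma> |\<union>| \<Delta>)) \<gamma>"
| impR: "seq E (finsert \<alpha> \<Gamma>) \<beta> \<Longrightarrow> seq E \<Gamma> (\<alpha> \<^bold>\<rightarrow> \<beta>)"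
| conjL: "seq E (finsert \<alpha> (finsert \<beta> \<Gamma>)) \<gamma> \<Longrightarrow> seq E (finsert (\<alpha> \<^bold>\<and> \<beta>) \<Gamma>) \<gamma>"
| conjR: "seq E \<Gamma> \<alpha> \<Longrightarrow> seq E \<Gamma> \<beta> \<Longrightarrow> seq E \<Gamma> (\<alpha> \<^bold>\<and> \<beta>)"
| disjL: "seq E (finsert \<alpha> \<Gamma>) \<gamma> \<Longrightarrow> seq E (finsert \<beta> \<Gamma>) \<gamma> \<Longrightarrow> seq E (finsert (\<alpha> \<^bold>\<or> \<beta>) \<Gamma>) \<gamma>"
| disjR1: "seq E \<Gamma> \<alpha> \<Longrightarrow> seq E \<Gamma> (\<alpha> \<^bold>\<or> \<beta>)"
| disjR2: "seq E \<Gamma> \<beta> \<Longrightarrow> seq E \<Gamma> (\<alpha> \<^bold>\<or> \<beta>)"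
| negL: "seq E (finsert \<alpha> \<Gamma>) \<gamma> \<Longrightarrow> seq E (finsert (\<^bold>\<sim> \<^bold>\<sim> \<alpha>) \<Gamma>) \<gamma>"
| negR: "seq E \<Gamma> \<alpha> \<Longrightarrow> seq E \<Gamma> (\<^bold>\<sim> \<^bold>\<sim> \<alpha>)"
| neg_impL: "seq E \<Gamma> \<alpha> \<Longrightarrow> seq E (finsert (\<^bold>\<sim> \<beta>) \<Delta>) \<gamma>
    \<Longrightarrow> seq E (finsert (\<^bold>\<sim> (\<alpha> \<^bold>\<rightarrow> \<beta>)) (\<Gamma> |\<union>| \<Delta>)) \<gamma>"
| neg_impR: "seq E (finsert \<alpha> \<Gamma>) (\<^bold>\<sim> \<beta>) \<Longrightarrow> seq E \<Gamma> (\<^bold>\<sim> (\<alpha> \<^bold>\<rightarrow> \<beta>))"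
| neg_conjL: "seq E (finsert (\<^bold>\<sim> \<alpha>) \<Gamma>) \<gamma> \<Longrightarrow> seq E (finsert (\<^bold>\<sim> \<beta>) \<Gamma>) \<gamma>
    \<Longrightarrow> seq E (finsert (\<^bold>\<sim> (\<alpha> \<^bold>\<and> \<beta>)) \<Gamma>) \<gamma>"
| neg_conjR1: "seq E \<Gamma> (\<^bold>\<sim> \<alpha>) \<Longrightarrow> seq E \<Gamma> (\<^bold>\<sim> (\<alpha> \<^bold>\<and> \<beta>))"
| neg_conjR2: "seq E \<Gamma> (\<^bold>\<sim> \<beta>) \<Longrightarrow> seq E \<Gamma> (\<^bold>\<sim> (\<alpha> \<^bold>\<and> \<beta>))"
| neg_disjL: "seq E (finsert (\<^bold>\<sim> \<alpha>) (finsert (\<^bold>\<sim> \<beta>) \<Gamma>)) \<gamma>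
    \<Longrightarrow> seq E (finsert (\<^bold>\<sim> (\<alpha> \<^bold>\<or> \<beta>)) \<Gamma>) \<gamma>"
| neg_disjR: "seq E \<Gamma> (\<^bold>\<sim> \<alpha>) \<Longrightarrow> seq E \<Gamma> (\<^bold>\<sim> \<beta>) \<Longrightarrow> seq E \<Gamma> (\<^bold>\<sim> (\<alpha> \<^bold>\<or> \<beta>))"
| ex_middle: "ExMiddle \<in> E \<Longrightarrow> seq E (finsert (\<^bold>\<sim> \<alpha>) \<Gamma>) \<gamma> \<Longrightarrow> seq E (finsert \<alpha> \<Gamma>) \<gamma> \<Longrightarrow> seq E \<Gamma> \<gamma>"
| g_ex_middle: "GExMiddle \<in> E \<Longrightarrow> seq E (finsert (\<alpha> \<^bold>\<rightarrow> \<beta>) \<Gamma>) \<gamma> \<Longrightarrow> seq E (finsert \<alpha> \<Gamma>) \<gamma>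
    \<Longrightarrow> seq E \<Gamma> \<gamma>"

definition sC :: "fm fset \<Rightarrow> fm \<Rightarrow> bool" where "sC = seq {}"
definition sC3 :: "fm fset \<Rightarrow> fm \<Rightarrow> bool" where "sC3 = seq {ExMiddle}"
definition sMC_star :: "fm fset \<Rightarrow> fm \<Rightarrow> bool" where "sMC_star = seq {GExMiddle}"
definition sCN_star :: "fm fset \<Rightarrow> fm \<Rightarrow> bool" where "sCN_star = seq {ExMiddle, GExMiddle}"

section \<open>Natural deduction systems\<close>

text \<open>\<open>nd E M \<gamma>\<close>: there is a derivation tree with end-formula \<open>\<gamma>\<close> whose open assumption
  occurrences form exactly the multiset \<open>M\<close>. A rule discharging \<open>[\<alpha>]\<close> removes
  \<open>replicate_mset n \<alpha>\<close> for an arbitrary \<open>n\<close>: it may discharge any number of the open occurrences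
  of \<open>\<alpha>\<close>, including none, and the remaining ones (which may include further copies of \<open>\<alpha>\<close>) stay
  open.\<close>

inductive nd :: "extra_rule set \<Rightarrow> fm multiset \<Rightarrow> fm \<Rightarrow> bool" for E where
  assum: "nd E {#\<alpha>#} \<alpha>"
| impI: "nd E (M + replicate_mset n \<alpha>) \<beta> \<Longrightarrow> nd E M (\<alpha> \<^bold>\<rightarrow> \<beta>)"
| impE: "nd E M (\<alpha> \<^bold>\<rightarrow> \<beta>) \<Longrightarrow> nd E N \<alpha> \<Longrightarrow> nd E (M + N) \<beta>"
| conjI: "nd E M \<alpha> \<Longrightarrow> nd E N \<beta> \<Longrightarrow> nd E (M + N) (\<alpha> \<^bold>\<and> \<beta>)"
| conjE1: "nd E M (\<alpha> \<^bold>\<and> \<beta>) \<Longrightarrow> nd E M \<alpha>"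
| conjE2: "nd E M (\<alpha> \<^bold>\<and> \<beta>) \<Longrightarrow> nd E M \<beta>"
| disjI1: "nd E M \<alpha> \<Longrightarrow> nd E M (\<alpha> \<^bold>\<or> \<beta>)"
| disjI2: "nd E M \<beta> \<Longrightarrow> nd E M (\<alpha> \<^bold>\<or> \<beta>)"
| disjE: "nd E M (\<alpha> \<^bold>\<or> \<beta>) \<Longrightarrow> nd E (N + replicate_mset n \<alpha>) \<gamma>
    \<Longrightarrow> nd E (K + replicate_mset k \<beta>) \<gamma> \<Longrightarrow> nd E (M + N + K) \<gamma>"
| neg_negI: "nd E M \<alpha> \<Longrightarrow> nd E M (\<^bold>\<sim> \<^bold>\<sim> \<alpha>)"
| neg_negE: "nd E M (\<^bold>\<sim> \<^bold>\<sim> \<alpha>) \<Longrightarrow> nd E M \<alpha>"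
| neg_impI: "nd E (M + replicate_mset n \<alpha>) (\<^bold>\<sim> \<beta>) \<Longrightarrow> nd E M (\<^bold>\<sim> (\<alpha> \<^bold>\<rightarrow> \<beta>))"
| neg_impE: "nd E M (\<^bold>\<sim> (\<alpha> \<^bold>\<rightarrow> \<beta>)) \<Longrightarrow> nd E N \<alpha> \<Longrightarrow> nd E (M + N) (\<^bold>\<sim> \<beta>)"
| neg_conjI1: "nd E M (\<^bold>\<sim> \<alpha>) \<Longrightarrow> nd E M (\<^bold>\<sim> (\<alpha> \<^bold>\<and> \<beta>))"
| neg_conjI2: "nd E M (\<^bold>\<sim> \<beta>) \<Longrightarrow> nd E M (\<^bold>\<sim> (\<alpha> \<^bold>\<and> \<beta>))"
| neg_conjE: "nd E M (\<^bold>\<sim> (\<alpha> \<^bold>\<and> \<beta>)) \<Longrightarrow> nd E (N + replicate_mset n (\<^bold>\<sim> \<alpha>)) \<gamma>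
    \<Longrightarrow> nd E (K + replicate_mset k (\<^bold>\<sim> \<beta>)) \<gamma> \<Longrightarrow> nd E (M + N + K) \<gamma>"
| neg_disjI: "nd E M (\<^bold>\<sim> \<alpha>) \<Longrightarrow> nd E N (\<^bold>\<sim> \<beta>) \<Longrightarrow> nd E (M + N) (\<^bold>\<sim> (\<alpha> \<^bold>\<or> \<beta>))"
| neg_disjE1: "nd E M (\<^bold>\<sim> (\<alpha> \<^bold>\<or> \<beta>)) \<Longrightarrow> nd E M (\<^bold>\<sim> \<alpha>)"
| neg_disjE2: "nd E M (\<^bold>\<sim> (\<alpha> \<^bold>\<or> \<beta>)) \<Longrightarrow> nd E M (\<^bold>\<sim> \<beta>)"
| EM: "ExMiddle \<in> E \<Longrightarrow> nd E (M + replicate_mset n (\<^bold>\<sim> \<alpha>)) \<gamma>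
    \<Longrightarrow> nd E (N + replicate_mset k \<alpha>) \<gamma> \<Longrightarrow> nd E (M + N) \<gamma>"
| GEM: "GExMiddle \<in> E \<Longrightarrow> nd E (M + replicate_mset n (\<alpha> \<^bold>\<rightarrow> \<beta>)) \<gamma>
    \<Longrightarrow> nd E (N + replicate_mset k \<alpha>) \<gamma> \<Longrightarrow> nd E (M + N) \<gamma>"

definition nC :: "fm multiset \<Rightarrow> fm \<Rightarrow> bool" where "nC = nd {}"
definition nC3 :: "fm multiset \<Rightarrow> fm \<Rightarrow> bool" where "nC3 = nd {ExMiddle}"
definition nMC :: "fm multiset \<Rightarrow> fm \<Rightarrow> bool" where "nMC = nd {GExMiddle}"
definition nCN :: "fm multiset \<Rightarrow> fm \<Rightarrow> bool" where "nCN = nd {ExMiddle, GExMiddle}"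

definition nd_provable :: "(fm multiset \<Rightarrow> fm \<Rightarrow> bool) \<Rightarrow> fm \<Rightarrow> bool" where
  "nd_provable N \<alpha> \<longleftrightarrow> N {#} \<alpha>"

end

theory Submission imports Defs begin

text \<open>Both calculi are compared through derivability from a set of admissible assumptions. Left
  rules become elimination rules followed by substitution of derivations, and an elimination rule
  becomes the left rule applied to identity sequents followed by a cut on its major premise.\<close>

section \<open>From sequents to natural deduction\<close>

text \<open>The set \<open>A\<close> only bounds the open assumptions. Unlike the exact multisets of
  \<open>nd\<close> it ignores multiplicities and permits weakening, which matches antecedents that
  are sets.\<close>

definition derives :: "extra_rule set \<Rightarrow> fm set \<Rightarrow> fm \<Rightarrow> bool" where
  "derives E A \<gamma> \<longleftrightarrow> (\<exists>M. set_mset M \<subseteq> A \<and> nd E M \<gamma>)"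

lemma derives_assum: "\<alpha> \<in> A \<Longrightarrow> derives E A \<alpha>"
  unfolding derives_def by (intro exI[of _ "{#\<alpha>#}"]) (auto intro: nd.assum)

lemma derives_mono: "derives E A \<gamma> \<Longrightarrow> A \<subseteq> B \<Longrightarrow> derives E B \<gamma>"
  unfolding derives_def by blast

text \<open>All occurrences of \<open>\<alpha>\<close> are split off together, even if
  \<open>\<alpha>\<close> is also in \<open>A\<close>; this is the shape that discharging rules
  expect. Here \<open>n\<close> may be 0, which amounts to vacuous discharge.\<close>

lemma derives_insertE:
  assumes "derives E (insert \<alpha> A) \<gamma>"
  obtains M n where "set_mset M \<subseteq> A" "nd E (M + replicate_mset n \<alpha>) \<gamma>"
proof -
  from assms obtain M where M: "set_mset M \<subseteq> insert \<alpha> A" "nd E M \<gamma>"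
    unfolding derives_def by blast
  have "M = filter_mset (\<lambda>x. x \<noteq> \<alpha>) M + replicate_mset (count M \<alpha>) \<alpha>"
    by (rule multiset_eqI) auto
  moreover have "set_mset (filter_mset (\<lambda>x. x \<noteq> \<alpha>) M) \<subseteq> A"
    using M(1) by auto
  ultimately show thesis using that M(2) by metis
qed

lemma derives_rule1:
  assumes "derives E A \<alpha>" and "\<And>M. nd E M \<alpha> \<Longrightarrow> nd E M \<gamma>"
  shows "derives E A \<gamma>"
  using assms unfolding derives_def by blast

lemma derives_rule2:
  assumes "derives E A \<alpha>" "derives E A \<beta>"
    and "\<And>M N. nd E M \<alpha> \<Longrightarrow> nd E N \<beta> \<Longrightarrow> nd E (M + N) \<gamma>"
  shows "derives E A \<gamma>"
proof -
  from assms(1,2) obtain M N where "set_mset M \<subseteq> A" "nd E M \<alpha>" "set_mset N \<subseteq> A" "nd E N \<beta>"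
    unfolding derives_def by blast
  then show ?thesis using assms(3)[of M N] unfolding derives_def
    by (intro exI[of _ "M + N"]) simp
qed

lemma derives_discharge:
  assumes "derives E (insert \<alpha> A) \<beta>"
    and "\<And>M n. nd E (M + replicate_mset n \<alpha>) \<beta> \<Longrightarrow> nd E M \<gamma>"
  shows "derives E A \<gamma>"
proof -
  from assms(1) obtain M n where "set_mset M \<subseteq> A" "nd E (M + replicate_mset n \<alpha>) \<beta>"
    by (rule derives_insertE)
  with assms(2) show ?thesis unfolding derives_def by blast
qed

lemma derives_impI: "derives E (insert \<alpha> A) \<beta> \<Longrightarrow> derives E A (\<alpha> \<^bold>\<rightarrow> \<beta>)"
  by (erule derives_discharge) (rule nd.impI)

lemma derives_neg_impI: "derives E (insert \<alpha> A) (\<^bold>\<sim> \<beta>) \<Longrightarrow> derives E A (\<^bold>\<sim> (\<alpha> \<^bold>\<rightarrow> \<beta>))"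
  by (erule derives_discharge) (rule nd.neg_impI)

lemma derives_impE: "derives E A (\<alpha> \<^bold>\<rightarrow> \<beta>) \<Longrightarrow> derives E A \<alpha> \<Longrightarrow> derives E A \<beta>"
  by (erule derives_rule2, assumption) (rule nd.impE)

lemma derives_neg_impE: "derives E A (\<^bold>\<sim> (\<alpha> \<^bold>\<rightarrow> \<beta>)) \<Longrightarrow> derives E A \<alpha> \<Longrightarrow> derives E A (\<^bold>\<sim> \<beta>)"
  by (erule derives_rule2, assumption) (rule nd.neg_impE)

text \<open>Substitution of derivations needs no induction over trees: \<open>\<alpha>\<close> is
  discharged by \<open>nd.impI\<close> and supplied again through \<open>nd.impE\<close>.\<close>

lemma derives_cut:
  assumes "derives E A \<alpha>" "derives E (insert \<alpha> B) \<gamma>" "A \<subseteq> C" "B \<subseteq> C"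
  shows "derives E C \<gamma>"
proof (rule derives_impE)
  show "derives E C (\<alpha> \<^bold>\<rightarrow> \<gamma>)"
    using assms derives_mono derives_impI by meson
  show "derives E C \<alpha>" using assms derives_mono by blast
qed

text \<open>Serves the two excluded-middle rules, whose case distinction has no major
  premise.\<close>

lemma derives_cases:
  assumes "derives E (insert \<alpha> A) \<gamma>" "derives E (insert \<beta> A) \<gamma>"
    and "\<And>M n N k. nd E (M + replicate_mset n \<alpha>) \<gamma> \<Longrightarrow> nd E (N + replicate_mset k \<beta>) \<gamma>
      \<Longrightarrow> nd E (M + N) \<gamma>"
  shows "derives E A \<gamma>"
proof -
  from assms(1,2) obtain M n N k where
    "set_mset M \<subseteq> A" "nd E (M + replicate_mset n \<alpha>) \<gamma>"
    "set_mset N \<subseteq> A" "nd E (N + replicate_mset k \<beta>) \<gamma>"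
    by (metis derives_insertE)
  then show ?thesis using assms(3)[of M n N k] unfolding derives_def
    by (intro exI[of _ "M + N"]) simp
qed

text \<open>Serves the left rules for disjunctions and negated conjunctions: the extra
  \<open>{#\<delta>#}\<close> is the major premise of the elimination rule, taken as an
  assumption.\<close>

lemma derives_case_left:
  assumes "derives E (insert \<alpha> A) \<gamma>" "derives E (insert \<beta> A) \<gamma>"
    and "\<And>M n N k. nd E (M + replicate_mset n \<alpha>) \<gamma> \<Longrightarrow> nd E (N + replicate_mset k \<beta>) \<gamma>
      \<Longrightarrow> nd E ({#\<delta>#} + M + N) \<gamma>"
  shows "derives E (insert \<delta> A) \<gamma>"
proof -
  from assms(1,2) obtain M n N k where
    "set_mset M \<subseteq> A" "nd E (M + replicate_mset n \<alpha>) \<gamma>"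
    "set_mset N \<subseteq> A" "nd E (N + replicate_mset k \<beta>) \<gamma>"
    by (metis derives_insertE)
  then show ?thesis using assms(3)[of M n N k] unfolding derives_def
    by (intro exI[of _ "{#\<delta>#} + M + N"]) auto
qed

lemma derives_left1:
  assumes "derives E (insert \<alpha> A) \<gamma>" and "\<And>M. nd E M \<delta> \<Longrightarrow> nd E M \<alpha>"
  shows "derives E (insert \<delta> A) \<gamma>"
proof (rule derives_cut[OF _ assms(1)])
  show "derives E {\<delta>} \<alpha>"
    by (rule derives_rule1[of _ _ \<delta>]) (simp_all add: derives_assum assms(2))
qed auto

lemma derives_left2:
  assumes "derives E (insert \<alpha> (insert \<beta> A)) \<gamma>"
    and "\<And>M. nd E M \<delta> \<Longrightarrow> nd E M \<alpha>" "\<And>M. nd E M \<delta> \<Longrightarrow> nd E M \<beta>"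
  shows "derives E (insert \<delta> A) \<gamma>"
proof -
  \<comment> \<open>The components are traded for \<open>\<delta>\<close> one at a time; the second
    copy of \<open>\<delta>\<close> is absorbed by the set.\<close>
  have "derives E (insert \<beta> (insert \<delta> A)) \<gamma>"
    using derives_left1[of E \<alpha> _ \<gamma> \<delta>, OF assms(1,2)] by (simp add: insert_commute)
  from derives_left1[of E \<beta> _ \<gamma> \<delta>, OF this assms(3)] show ?thesis by simp
qed

text \<open>Abstracting the elimination rule lets one argument cover plain and negated implications;
  for the latter, \<open>\<beta>\<close> is instantiated with a negated consequent.\<close>

lemma derives_left_imp:
  assumes "derives E A \<alpha>" "derives E (insert \<beta> B) \<gamma>"
    and "\<And>C. derives E C \<delta> \<Longrightarrow> derives E C \<alpha> \<Longrightarrow> derives E C \<beta>"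
  shows "derives E (insert \<delta> (A \<union> B)) \<gamma>"
proof (rule derives_cut[OF _ assms(2)])
  show "derives E (insert \<delta> A) \<beta>"
    by (intro assms(3) derives_assum derives_mono[OF assms(1)]) auto
qed auto

lemma derives_if_seq: "seq E \<Gamma> \<gamma> \<Longrightarrow> derives E (fset \<Gamma>) \<gamma>"
proof (induction rule: seq.induct)
  case (cut \<Gamma> \<alpha> \<Sigma> \<gamma>)
  then show ?case using derives_cut[of E "fset \<Gamma>" \<alpha> "fset \<Sigma>" \<gamma>] by simp
next
  case (impL \<Gamma> \<alpha> \<beta> \<Delta> \<gamma>)
  from impL.IH show ?case unfolding finsert.rep_eq union_fset
    by (rule derives_left_imp) (rule derives_impE)
next
  case (neg_impL \<Gamma> \<alpha> \<beta> \<Delta> \<gamma>)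
  from neg_impL.IH show ?case unfolding finsert.rep_eq union_fset
    by (rule derives_left_imp) (rule derives_neg_impE)
next
  case (impR \<alpha> \<Gamma> \<beta>)
  then show ?case by (simp add: derives_impI)
next
  case (neg_impR \<alpha> \<Gamma> \<beta>)
  then show ?case by (simp add: derives_neg_impI)
next
  case (conjL \<alpha> \<beta> \<Gamma> \<gamma>)
  from conjL.IH show ?case unfolding finsert.rep_eq
    by (rule derives_left2) (fact nd.conjE1 nd.conjE2)+
next
  case (conjR \<Gamma> \<alpha> \<beta>)
  from conjR.IH show ?case by (rule derives_rule2) (rule nd.conjI)
next
  case (disjL \<alpha> \<Gamma> \<gamma> \<beta>)
  from disjL.IH show ?case unfolding finsert.rep_eq
    by (rule derives_case_left) (rule nd.disjE[OF nd.assum])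
next
  case (disjR1 \<Gamma> \<alpha> \<beta>)
  from disjR1.IH show ?case by (rule derives_rule1) (rule nd.disjI1)
next
  case (disjR2 \<Gamma> \<beta> \<alpha>)
  from disjR2.IH show ?case by (rule derives_rule1) (rule nd.disjI2)
next
  case (negL \<alpha> \<Gamma> \<gamma>)
  from negL.IH show ?case unfolding finsert.rep_eq
    by (rule derives_left1) (rule nd.neg_negE)
next
  case (negR \<Gamma> \<alpha>)
  from negR.IH show ?case by (rule derives_rule1) (rule nd.neg_negI)
next
  case (neg_conjL \<alpha> \<Gamma> \<gamma> \<beta>)
  from neg_conjL.IH show ?case unfolding finsert.rep_eq
    by (rule derives_case_left) (rule nd.neg_conjE[OF nd.assum])
next
  case (neg_conjR1 \<Gamma> \<alpha> \<beta>)
  from neg_conjR1.IH show ?case by (rule derives_rule1) (rule nd.neg_conjI1)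
next
  case (neg_conjR2 \<Gamma> \<beta> \<alpha>)
  from neg_conjR2.IH show ?case by (rule derives_rule1) (rule nd.neg_conjI2)
next
  case (neg_disjL \<alpha> \<beta> \<Gamma> \<gamma>)
  from neg_disjL.IH show ?case unfolding finsert.rep_eq
    by (rule derives_left2) (fact nd.neg_disjE1 nd.neg_disjE2)+
next
  case (neg_disjR \<Gamma> \<alpha> \<beta>)
  from neg_disjR.IH show ?case by (rule derives_rule2) (rule nd.neg_disjI)
next
  case (ex_middle \<alpha> \<Gamma> \<gamma>)
  from ex_middle.IH show ?case unfolding finsert.rep_eq
    by (rule derives_cases) (rule nd.EM[OF ex_middle.hyps(1)])
next
  case (g_ex_middle \<alpha> \<beta> \<Gamma> \<gamma>)
  from g_ex_middle.IH show ?case unfolding finsert.rep_eq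
    by (rule derives_cases) (rule nd.GEM[OF g_ex_middle.hyps(1)])
qed (simp_all add: derives_assum)

section \<open>From natural deduction to sequents\<close>

text \<open>The identity sequents are hypotheses because this is applied inside the induction that
  establishes them. With \<open>\<alpha>\<close> outermost, \<open>seq.impR\<close> applies directly
  to the result.\<close>

lemma seq_imp_axiom:
  assumes "\<And>\<Gamma>. seq E (finsert \<alpha> \<Gamma>) \<alpha>" "\<And>\<Gamma>. seq E (finsert \<beta> \<Gamma>) \<beta>"
  shows "seq E (finsert \<alpha> (finsert (\<alpha> \<^bold>\<rightarrow> \<beta>) \<Gamma>)) \<beta>"
  using seq.impL[OF assms(1) assms(2), of \<Gamma> \<Gamma>] by (simp add: finsert_commute)

lemma seq_neg_imp_axiom:
  assumes "\<And>\<Gamma>. seq E (finsert \<alpha> \<Gamma>) \<alpha>" "\<And>\<Gamma>. seq E (finsert (\<^bold>\<sim> \<beta>) \<Gamma>) (\<^bold>\<sim> \<beta>)"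
  shows "seq E (finsert \<alpha> (finsert (\<^bold>\<sim> (\<alpha> \<^bold>\<rightarrow> \<beta>)) \<Gamma>)) (\<^bold>\<sim> \<beta>)"
  using seq.neg_impL[OF assms(1) assms(2), of \<Gamma> \<Gamma>] by (simp add: finsert_commute)

text \<open>The negated half is needed because the rules for \<open>\<^bold>\<sim>\<close> decompose the formula below it.\<close>

lemma seq_axiom_both:
  "(\<forall>\<Gamma>. seq E (finsert \<alpha> \<Gamma>) \<alpha>) \<and> (\<forall>\<Gamma>. seq E (finsert (\<^bold>\<sim> \<alpha>) \<Gamma>) (\<^bold>\<sim> \<alpha>))"
proof (induction \<alpha>)
  case (Var p)
  show ?case by (simp add: seq.init1 seq.init2)
next
  case (Conj \<alpha> \<beta>)
  \<comment> \<open>\<open>seq.conjL\<close> puts both conjuncts into one antecedent, so each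
    identity sequent is needed with the other conjunct as context.\<close>
  then have "seq E (finsert \<alpha> (finsert \<beta> \<Gamma>)) \<alpha>" "seq E (finsert \<alpha> (finsert \<beta> \<Gamma>)) \<beta>" for \<Gamma>
    by (simp, metis finsert_commute)
  with Conj show ?case
    by (auto intro!: seq.conjL[OF seq.conjR] seq.neg_conjL[OF seq.neg_conjR1 seq.neg_conjR2])
next
  case (Disj \<alpha> \<beta>)
  then have "seq E (finsert (\<^bold>\<sim> \<alpha>) (finsert (\<^bold>\<sim> \<beta>) \<Gamma>)) (\<^bold>\<sim> \<alpha>)"
    "seq E (finsert (\<^bold>\<sim> \<alpha>) (finsert (\<^bold>\<sim> \<beta>) \<Gamma>)) (\<^bold>\<sim> \<beta>)" for \<Gamma>
    by (simp, metis finsert_commute)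
  with Disj show ?case
    by (auto intro!: seq.disjL[OF seq.disjR1 seq.disjR2] seq.neg_disjL[OF seq.neg_disjR])
next
  case (Imp \<alpha> \<beta>)
  then show ?case
    by (simp add: seq.impR seq.neg_impR seq_imp_axiom seq_neg_imp_axiom)
next
  case (Neg \<alpha>)
  \<comment> \<open>The first half of the goal is the second half of the induction hypothesis; the
    double negation reduces to the identity for \<open>\<alpha>\<close>.\<close>
  then show ?case by (auto intro: seq.negL seq.negR)
qed

lemma seq_axiom: "seq E (finsert \<alpha> \<Gamma>) \<alpha>"
  using seq_axiom_both by blast

lemma seq_cut: "seq E \<Gamma> \<alpha> \<Longrightarrow> seq E (finsert \<alpha> \<Gamma>) \<gamma> \<Longrightarrow> seq E \<Gamma> \<gamma>"
  using seq.cut[of E \<Gamma> \<alpha> \<Gamma> \<gamma>] by simp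

lemma seq_impE:
  assumes "seq E \<Gamma> (\<alpha> \<^bold>\<rightarrow> \<beta>)" "seq E \<Gamma> \<alpha>"
  shows "seq E \<Gamma> \<beta>"
  using seq_cut[OF assms(1)] seq.impL[OF assms(2) seq_axiom, of \<beta> \<Gamma>] by simp

lemma seq_neg_impE:
  assumes "seq E \<Gamma> (\<^bold>\<sim> (\<alpha> \<^bold>\<rightarrow> \<beta>))" "seq E \<Gamma> \<alpha>"
  shows "seq E \<Gamma> (\<^bold>\<sim> \<beta>)"
  using seq_cut[OF assms(1)] seq.neg_impL[OF assms(2) seq_axiom, of \<beta> \<Gamma>] by simp

text \<open>Quantifying over all antecedents that contain the open assumptions builds weakening into
  the induction: it aligns the contexts of the premises and covers vacuous and partial
  discharge.\<close>

lemma seq_if_nd: "nd E M \<gamma> \<Longrightarrow> set_mset M \<subseteq> fset \<Gamma> \<Longrightarrow> seq E \<Gamma> \<gamma>"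
proof (induction arbitrary: \<Gamma> rule: nd.induct)
  case (assum \<alpha>)
  then have "finsert \<alpha> \<Gamma> = \<Gamma>" by auto
  then show ?case using seq_axiom by metis
next
  case (impI M n \<alpha> \<beta>)
  \<comment> \<open>The split separates \<open>n = 0\<close>, where no copy of
    \<open>\<alpha>\<close> is discharged, from positive \<open>n\<close>.\<close>
  then show ?case by (intro seq.impR impI.IH) (auto split: if_splits)
next
  case (impE M \<alpha> \<beta> N)
  then show ?case by (auto intro: seq_impE)
next
  case (conjE1 M \<alpha> \<beta>)
  then show ?case by (blast intro: seq_cut seq.conjL seq_axiom)
next
  case (conjE2 M \<alpha> \<beta>)
  have "seq E (finsert \<alpha> (finsert \<beta> \<Gamma>)) \<beta>"
    using seq_axiom by (metis finsert_commute)
  with conjE2 show ?case by (blast intro: seq_cut seq.conjL)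
next
  case (disjE M \<alpha> \<beta> N n \<gamma> K k)
  \<comment> \<open>The minor premises are used at \<open>\<Gamma>\<close> enlarged by their case
    formulas; the major premise then cuts the disjunction away.\<close>
  have "seq E (finsert (\<alpha> \<^bold>\<or> \<beta>) \<Gamma>) \<gamma>"
    using disjE.prems by (intro seq.disjL disjE.IH) (auto split: if_splits)
  moreover have "seq E \<Gamma> (\<alpha> \<^bold>\<or> \<beta>)" using disjE by auto
  ultimately show ?case by (blast intro: seq_cut)
next
  case (neg_negE M \<alpha>)
  then show ?case by (blast intro: seq_cut seq.negL seq_axiom)
next
  case (neg_impI M n \<alpha> \<beta>)
  then show ?case by (intro seq.neg_impR neg_impI.IH) (auto split: if_splits)
next
  case (neg_impE M \<alpha> \<beta> N)
  then show ?case by (auto intro: seq_neg_impE)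
next
  case (neg_conjE M \<alpha> \<beta> N n \<gamma> K k)
  have "seq E (finsert (\<^bold>\<sim> (\<alpha> \<^bold>\<and> \<beta>)) \<Gamma>) \<gamma>"
    using neg_conjE.prems by (intro seq.neg_conjL neg_conjE.IH) (auto split: if_splits)
  moreover have "seq E \<Gamma> (\<^bold>\<sim> (\<alpha> \<^bold>\<and> \<beta>))" using neg_conjE by auto
  ultimately show ?case by (blast intro: seq_cut)
next
  case (neg_disjE1 M \<alpha> \<beta>)
  then show ?case by (blast intro: seq_cut seq.neg_disjL seq_axiom)
next
  case (neg_disjE2 M \<alpha> \<beta>)
  have "seq E (finsert (\<^bold>\<sim> \<alpha>) (finsert (\<^bold>\<sim> \<beta>) \<Gamma>)) (\<^bold>\<sim> \<beta>)"
    using seq_axiom by (metis finsert_commute)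
  with neg_disjE2 show ?case by (blast intro: seq_cut seq.neg_disjL)
next
  case (EM M n \<alpha> \<gamma> N k)
  show ?case
    using EM.prems by (intro seq.ex_middle[OF EM.hyps(1) EM.IH]) (auto split: if_splits)
next
  case (GEM M n \<alpha> \<beta> \<gamma> N k)
  show ?case
    using GEM.prems by (intro seq.g_ex_middle[OF GEM.hyps(1) GEM.IH]) (auto split: if_splits)
qed (auto intro: seq.conjR seq.disjR1 seq.disjR2 seq.negR seq.neg_conjR1 seq.neg_conjR2
      seq.neg_disjR)

lemma seq_fempty_iff: "seq E {||} \<alpha> \<longleftrightarrow> nd E {#} \<alpha>"
proof
  assume "seq E {||} \<alpha>"
  then show "nd E {#} \<alpha>"
    \<comment> \<open>Open assumptions bounded by the empty set form the empty multiset, so the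
      derivation is closed.\<close>
    using derives_if_seq unfolding derives_def by fastforce
next
  assume "nd E {#} \<alpha>"
  then show "seq E {||} \<alpha>" by (rule seq_if_nd) simp
qed

theorem theorem3p8:
  fixes N :: "fm multiset \<Rightarrow> fm \<Rightarrow> bool" and S :: "fm fset \<Rightarrow> fm \<Rightarrow> bool" and \<alpha> :: fm
  assumes "(N, S) \<in> {(nC, sC), (nC3, sC3), (nMC, sMC_star), (nCN, sCN_star)}"
  shows "S {||} \<alpha> \<longleftrightarrow> nd_provable N \<alpha>"
  \<comment> \<open>In each pair both systems have the same rule set \<open>E\<close>, so the
    equivalence, uniform in \<open>E\<close>, covers all four.\<close>
  using assms seq_fempty_iff
  unfolding nd_provable_def nC_def nC3_def nMC_def nCN_def sC_def sC3_def sMC_star_def sCN_star_def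
  by auto

end
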